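(* Any $1$-differential operator on the Virasoro algebra $\mathrm{Vir}$ is of the form $d_{0,0}$ or $d_{n,a}$ for some $n\in\mathbb{Z}\setminus\{0\}$ and $a\in\mathbb{C}\setminus\{0\}$. For $\lambda\in\mathbb{C}\setminus\{0\}$, any $\lambda$-differential operator on $\mathrm{Vir}$ is one of $\lambda^{-1}d_{0,0}$ or $\lambda^{-1}d_{n,a}$ for some $n\in\mathbb{Z}\setminus\{0\}$ and $a\in\mathbb{C}\setminus\{0\}$.
   Context: All spaces and algebras are over $\mathbb{C}$ and all linear maps are $\mathbb{C}$-linear. For a Lie algebra $\mathcal{L}$ and $\lambda\in\mathbb{C}$, a $\lambda$-differential operator on $\mathcal{L}$ is a linear map $d:\mathcal{L}\to\mathcal{L}$ such that $d[x,y]=[d(x),y]+[x,d(y)]+\lambda[d(x),d(y)]$ for all $x,y\in\mathcal{L}$. The Virasoro algebra $\mathrm{Vir}$ is the complex Lie algebra with basis $\{L_n, C \mid n\in\mathbb{Z}\}$ and brackets $[L_m,L_n]=(n-m)L_{n+m}+\delta_{n,-m}\frac{m^3-m}{12}C$, $[C,L_m]=0$ for $m,n\in\mathbb{Z}$. For $n\in\mathbb{Z}\setminus\{0\}$ and $a\in\mathbb{C}\setminus\{0\}$ define Lie algebra homomorphisms $\varphi_n,\tau_a:\mathrm{Vir}\to\mathrm{Vir}$ by $\varphi_n(L_i)=\frac1n\left(L_{ni}-\delta_{i,0}\frac{n^2-1}{24}C\right)$, $\varphi_n(C)=nC$, and $\tau_a(L_i)=a^iL_i$, $\tau_a(C)=C$.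 Put $d_{0,0}:=-\mathrm{id}_{\mathrm{Vir}}$ and $d_{n,a}:=\varphi_n\tau_a-\mathrm{id}_{\mathrm{Vir}}$ (where $\varphi_n\tau_a$ is the composition $\varphi_n\circ\tau_a$). *)

theory Defs
  imports Complex_Main "HOL-Library.Poly_Mapping"
begin

section \<open>Complex Lie algebras and differential operators of weight \<open>\<lambda>\<close>\<close>

locale complex_lie_algebra = vector_space scale
  for scale :: "complex \<Rightarrow> 'a::ab_group_add \<Rightarrow> 'a" +
  fixes bracket :: "'a \<Rightarrow> 'a \<Rightarrow> 'a"
  assumes bracket_linear_right: "Vector_Spaces.linear scale scale (bracket x)"
    and bracket_linear_left: "Vector_Spaces.linear scale scale (\<lambda>x. bracket x y)"
    and bracket_self: "bracket x x = 0"
    and jacobi: "bracket x (bracket y z) + bracket y (bracket z x) + bracket z (bracket x y) = 0"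
begin

definition differential_operator :: "complex \<Rightarrow> ('a \<Rightarrow> 'a) \<Rightarrow> bool" where
  "differential_operator lam d \<longleftrightarrow>
     Vector_Spaces.linear scale scale d \<and>
     (\<forall>x y. d (bracket x y) =
        bracket (d x) y + bracket x (d y) + scale lam (bracket (d x) (d y)))"

definition lie_endomorphism :: "('a \<Rightarrow> 'a) \<Rightarrow> bool" where
  "lie_endomorphism f \<longleftrightarrow>
     Vector_Spaces.linear scale scale f \<and> (\<forall>x y. f (bracket x y) = bracket (f x) (f y))"

end


section \<open>The Virasoro algebra\<close>

text \<open>The underlying space is the space of finitely supported complex functions on the index
  set \<open>{L_n | n \<in> \<int>} \<union> {C}\<close>, that is, the complex vector space with these symbols as a basis.\<close>

datatype vir_index = Lix int | Cix

type_synonym vir = "vir_index \<Rightarrow>\<^sub>0 complex"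

definition vir_scale :: "complex \<Rightarrow> vir \<Rightarrow> vir" where
  "vir_scale c x = Poly_Mapping.map ((*) c) x"

definition vir_L :: "int \<Rightarrow> vir" where
  "vir_L n = Poly_Mapping.single (Lix n) 1"

definition vir_C :: vir where
  "vir_C = Poly_Mapping.single Cix 1"

lemma lookup_vir_L: "Poly_Mapping.lookup (vir_L n) k = (if k = Lix n then 1 else 0)"
  and lookup_vir_C: "Poly_Mapping.lookup vir_C k = (if k = Cix then 1 else 0)"
  by (auto simp: vir_L_def vir_C_def lookup_single when_def)

text \<open>The linear map with prescribed values on the basis.\<close>

definition vir_extend :: "(vir_index \<Rightarrow> vir) \<Rightarrow> vir \<Rightarrow> vir" where
  "vir_extend f x =
     (\<Sum>i\<in>Poly_Mapping.keys x. vir_scale (Poly_Mapping.lookup x i) (f i))"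

fun vir_basis_bracket :: "vir_index \<Rightarrow> vir_index \<Rightarrow> vir" where
  "vir_basis_bracket (Lix m) (Lix n) =
     vir_scale (of_int (n - m)) (vir_L (n + m)) +
     (if n = - m then vir_scale ((of_int m ^ 3 - of_int m) / 12) vir_C else 0)"
| "vir_basis_bracket Cix _ = 0"
| "vir_basis_bracket _ Cix = 0"

definition vir_bracket :: "vir \<Rightarrow> vir \<Rightarrow> vir" where
  "vir_bracket x y = vir_extend (\<lambda>i. vir_extend (vir_basis_bracket i) y) x"

lemma lookup_vir_scale [simp]:
  "Poly_Mapping.lookup (vir_scale c x) i = c * Poly_Mapping.lookup x i"
  unfolding vir_scale_def by (simp add: Poly_Mapping.map.rep_eq when_def)

lemma vector_space_vir: "vector_space vir_scale"
  by unfold_locales (auto intro!: poly_mapping_eqI simp: lookup_add algebra_simps)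

interpretation vir_vs: vector_space vir_scale
  by (rule vector_space_vir)

lemma vir_extend_superset:
  assumes "finite A" "Poly_Mapping.keys x \<subseteq> A"
  shows "vir_extend f x = (\<Sum>i\<in>A. vir_scale (Poly_Mapping.lookup x i) (f i))"
  unfolding vir_extend_def
  by (rule sum.mono_neutral_left) (use assms in \<open>auto simp: in_keys_iff\<close>)

lemma vir_extend_add: "vir_extend f (x + y) = vir_extend f x + vir_extend f y"
proof -
  let ?A = "Poly_Mapping.keys x \<union> Poly_Mapping.keys y"
  have "Poly_Mapping.keys (x + y) \<subseteq> ?A" by (rule keys_add)
  then show ?thesis
    by (simp add: vir_extend_superset[of ?A] lookup_add vir_vs.scale_left_distrib sum.distrib)
qed

lemma vir_extend_scale: "vir_extend f (vir_scale c x) = vir_scale c (vir_extend f x)"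
proof -
  have "Poly_Mapping.keys (vir_scale c x) \<subseteq> Poly_Mapping.keys x"
    by (auto simp: in_keys_iff)
  then show ?thesis
    by (simp add: vir_extend_superset[of "Poly_Mapping.keys x"] vir_vs.scale_sum_right)
qed

lemma vir_linearI:
  assumes "\<And>x y. f (x + y) = f x + f y" "\<And>c x. f (vir_scale c x) = vir_scale c (f x)"
  shows "Vector_Spaces.linear vir_scale vir_scale f"
  using assms vector_space_vir
  by (simp add: Vector_Spaces.linear_def module_hom_def module_hom_axioms_def
      module_iff_vector_space)

lemma linear_vir_extend: "Vector_Spaces.linear vir_scale vir_scale (vir_extend f)"
  by (rule vir_linearI) (auto simp: vir_extend_add vir_extend_scale)

lemma vir_extend_single [simp]: "vir_extend f (Poly_Mapping.single i 1) = f i"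
  by (simp add: vir_extend_def)

lemma vir_extend_L [simp]: "vir_extend f (vir_L n) = f (Lix n)"
  and vir_extend_C [simp]: "vir_extend f vir_C = f Cix"
  by (simp_all add: vir_L_def vir_C_def)

lemma vir_expand: "x = vir_extend (\<lambda>i. Poly_Mapping.single i 1) x"
  by (rule poly_mapping_eqI)
    (simp add: vir_extend_def lookup_sum lookup_single when_def in_keys_iff if_distrib
      cong: if_cong)

text \<open>Properties closed under linear combinations may be checked on the basis.\<close>

lemma vir_induct:
  assumes "P 0" "\<And>x y. P x \<Longrightarrow> P y \<Longrightarrow> P (x + y)" "\<And>c x. P x \<Longrightarrow> P (vir_scale c x)"
    and "\<And>n. P (vir_L n)" "P vir_C"
  shows "P x"
proof -
  have b: "P (Poly_Mapping.single i 1)" for i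
    using assms(4,5) by (cases i) (auto simp: vir_L_def vir_C_def)
  have "P (\<Sum>i\<in>A. vir_scale (Poly_Mapping.lookup x i) (Poly_Mapping.single i 1))"
    if "finite A" for A
    using that by induction (auto intro: assms b)
  from this[OF finite_keys, of x] show ?thesis
    using vir_expand[of x] unfolding vir_extend_def by (rule back_subst[where P = P, OF _ sym])
qed

lemma vir_extend_fun_add:
  "vir_extend (\<lambda>i. f i + g i) x = vir_extend f x + vir_extend g x"
  by (simp add: vir_extend_def vir_vs.scale_right_distrib sum.distrib)

lemma vir_extend_fun_scale:
  "vir_extend (\<lambda>i. vir_scale c (f i)) x = vir_scale c (vir_extend f x)"
  by (simp add: vir_extend_def vir_vs.scale_sum_right mult.commute)

lemma vir_bracket_add_left: "vir_bracket (x + y) z = vir_bracket x z + vir_bracket y z"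
  and vir_bracket_add_right: "vir_bracket x (y + z) = vir_bracket x y + vir_bracket x z"
  and vir_bracket_scale_left: "vir_bracket (vir_scale c x) y = vir_scale c (vir_bracket x y)"
  and vir_bracket_scale_right: "vir_bracket x (vir_scale c y) = vir_scale c (vir_bracket x y)"
  by (simp_all add: vir_bracket_def vir_extend_add vir_extend_scale vir_extend_fun_add
      vir_extend_fun_scale)

lemma vir_bracket_zero_left: "vir_bracket 0 y = 0"
  and vir_bracket_zero_right: "vir_bracket x 0 = 0"
  by (simp_all add: vir_bracket_def vir_extend_def)

lemma vir_bracket_diff_left: "vir_bracket (x - y) z = vir_bracket x z - vir_bracket y z"
  and vir_bracket_diff_right: "vir_bracket x (y - z) = vir_bracket x y - vir_bracket x z"
  using vir_bracket_add_left[of "x - y" y z] vir_bracket_add_right[of x "y - z" z] by simp_all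

lemma vir_bracket_minus_left: "vir_bracket (- x) y = - vir_bracket x y"
  and vir_bracket_minus_right: "vir_bracket x (- y) = - vir_bracket x y"
  using vir_bracket_diff_left[of 0 x y] vir_bracket_diff_right[of x 0 y]
  by (simp_all add: vir_bracket_zero_left vir_bracket_zero_right)

lemmas vir_bracket_bilinear =
  vir_bracket_diff_left vir_bracket_diff_right vir_bracket_minus_left vir_bracket_minus_right
  vir_bracket_add_left vir_bracket_add_right vir_bracket_scale_left vir_bracket_scale_right
  vir_bracket_zero_left vir_bracket_zero_right

lemma vir_bracket_L_L:
  "vir_bracket (vir_L m) (vir_L n) =
     vir_scale (of_int (n - m)) (vir_L (n + m)) +
     (if n = - m then vir_scale ((of_int m ^ 3 - of_int m) / 12) vir_C else 0)"
  by (simp add: vir_bracket_def)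

lemma vir_bracket_C_left: "vir_bracket vir_C x = 0"
  and vir_bracket_C_right: "vir_bracket x vir_C = 0"
proof -
  show "vir_bracket vir_C x = 0"
    by (simp add: vir_bracket_def) (simp add: vir_extend_def)
  have "vir_basis_bracket i Cix = 0" for i by (cases i) auto
  then show "vir_bracket x vir_C = 0"
    by (simp add: vir_bracket_def) (simp add: vir_extend_def)
qed

lemma vir_bracket_anti: "vir_bracket x y = - vir_bracket y x"
proof (induction x rule: vir_induct)
  case (4 m)
  show ?case
  proof (induction y rule: vir_induct)
    case (4 n)
    show ?case
      by (rule poly_mapping_eqI)
        (auto simp: vir_bracket_L_L lookup_add lookup_minus add.commute field_simps power3_eq_cube
          lookup_vir_L lookup_vir_C add_eq_0_iff)
  qed (simp_all add: vir_bracket_bilinear vir_bracket_C_left vir_bracket_C_right)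
qed (simp_all add: vir_bracket_bilinear vir_bracket_C_left vir_bracket_C_right)

lemma vir_jacobi:
  "vir_bracket x (vir_bracket y z) + vir_bracket y (vir_bracket z x) +
   vir_bracket z (vir_bracket x y) = 0" (is "?J x y z = 0")
proof -
  have add: "?J (x + x') y z = ?J x y z + ?J x' y z" for x x' y z
    by (simp add: vir_bracket_bilinear algebra_simps)
  have scale: "?J (vir_scale c x) y z = vir_scale c (?J x y z)" for c x y z
    by (simp add: vir_bracket_bilinear vir_vs.scale_right_distrib)
  have zero: "?J 0 y z = 0" for y z
    by (simp add: vir_bracket_bilinear)
  have C: "?J vir_C y z = 0" for y z
    by (simp add: vir_bracket_bilinear vir_bracket_C_left vir_bracket_C_right)
  have rot: "?J x y z = ?J y z x" for x y z
    by (simp add: algebra_simps)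
  have LLL: "?J (vir_L m) (vir_L n) (vir_L p) = 0" for m n p
  proof (cases "m + n + p = 0")
    case True
    then have p: "p = - m - n" by simp
    show ?thesis unfolding p
      by (rule poly_mapping_eqI)
        (auto simp: vir_bracket_L_L vir_bracket_bilinear vir_bracket_C_right lookup_add lookup_minus
          lookup_vir_L lookup_vir_C field_simps power3_eq_cube)
  next
    case False
    then have "n + p \<noteq> - m" "p + m \<noteq> - n" "m + n \<noteq> - p" by auto
    then show ?thesis
      by (intro poly_mapping_eqI)
        (auto simp: vir_bracket_L_L vir_bracket_bilinear vir_bracket_C_right lookup_add lookup_minus
          lookup_vir_L lookup_vir_C algebra_simps)
  qed
  have LL: "?J (vir_L m) (vir_L n) z = 0" for m n z
  proof -
    have "?J z (vir_L m) (vir_L n) = 0"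
      by (induction z rule: vir_induct) (simp_all only: zero add scale LLL C, simp_all)
    then show ?thesis using rot by metis
  qed
  have L: "?J (vir_L m) y z = 0" for m y z
  proof -
    have "?J y z (vir_L m) = 0"
    proof (induction y rule: vir_induct)
      case (4 n)
      have "?J (vir_L n) z (vir_L m) = ?J (vir_L m) (vir_L n) z" using rot by metis
      then show ?case by (simp only: LL)
    qed (simp_all only: zero add scale C, simp_all)
    then show ?thesis using rot by metis
  qed
  show ?thesis
    by (induction x rule: vir_induct) (simp_all only: zero add scale L C, simp_all)
qed

global_interpretation vir: complex_lie_algebra vir_scale vir_bracket
proof (intro complex_lie_algebra.intro complex_lie_algebra_axioms.intro)
  show "vir_bracket x x = 0" for x
  proof (rule poly_mapping_eqI)
    fix k
    have "Poly_Mapping.lookup (vir_bracket x x) k = - Poly_Mapping.lookup (vir_bracket x x) k"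
      using vir_bracket_anti[of x x] by (metis lookup_uminus)
    then show "Poly_Mapping.lookup (vir_bracket x x) k = Poly_Mapping.lookup 0 k"
      by (simp add: equation_minus_iff)
  qed
qed (auto intro: vector_space_vir vir_linearI vir_jacobi simp: vir_bracket_bilinear)


section \<open>The endomorphisms \<open>\<phi>\<^sub>n\<close>, \<open>\<tau>\<^sub>a\<close> and the operators \<open>d\<close>\<close>

text \<open>These are meant for \<open>n \<noteq> 0\<close> and \<open>a \<noteq> 0\<close> only.\<close>

definition vir_phi :: "int \<Rightarrow> vir \<Rightarrow> vir" where
  "vir_phi n = vir_extend (\<lambda>k. case k of
     Lix i \<Rightarrow> vir_scale (1 / of_int n)
       (vir_L (n * i) - (if i = 0 then vir_scale ((of_int n ^ 2 - 1) / 24) vir_C else 0))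
   | Cix \<Rightarrow> vir_scale (of_int n) vir_C)"

definition vir_tau :: "complex \<Rightarrow> vir \<Rightarrow> vir" where
  "vir_tau a = vir_extend (\<lambda>k. case k of
     Lix i \<Rightarrow> vir_scale (a powi i) (vir_L i)
   | Cix \<Rightarrow> vir_C)"

definition vir_d00 :: "vir \<Rightarrow> vir" where
  "vir_d00 = (\<lambda>x. - x)"

definition vir_d :: "int \<Rightarrow> complex \<Rightarrow> vir \<Rightarrow> vir" where
  "vir_d n a = (\<lambda>x. (vir_phi n \<circ> vir_tau a) x - x)"

lemma vir_endomorphismI:
  assumes f: "f = vir_extend g"
    and LL: "\<And>m n. f (vir_bracket (vir_L m) (vir_L n)) = vir_bracket (f (vir_L m)) (f (vir_L n))"
    and C: "\<And>x. vir_bracket (f vir_C) x = 0"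
  shows "vir.lie_endomorphism f"
proof -
  have lin: "f (x + y) = f x + f y" "f (vir_scale c x) = vir_scale c (f x)" "f 0 = 0" for x y c
    by (simp_all add: f vir_extend_add vir_extend_scale) (simp add: vir_extend_def)
  have C': "vir_bracket x (f vir_C) = 0" for x
    using C vir_bracket_anti[of x "f vir_C"] by simp
  have "f (vir_bracket x y) = vir_bracket (f x) (f y)" for x y
  proof (induction x rule: vir_induct)
    case (4 m)
    show ?case
      by (induction y rule: vir_induct)
        (simp_all add: lin LL C' vir_bracket_bilinear vir_bracket_C_right)
  qed (simp_all add: lin C vir_bracket_bilinear vir_bracket_C_left)
  then show ?thesis
    by (simp add: vir.lie_endomorphism_def f linear_vir_extend)
qed

lemma vir_phi_C: "vir_phi n vir_C = vir_scale (of_int n) vir_C"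
  and vir_phi_L: "vir_phi n (vir_L i) = vir_scale (1 / of_int n)
       (vir_L (n * i) - (if i = 0 then vir_scale ((of_int n ^ 2 - 1) / 24) vir_C else 0))"
  and vir_tau_C: "vir_tau a vir_C = vir_C"
  and vir_tau_L: "vir_tau a (vir_L i) = vir_scale (a powi i) (vir_L i)"
  by (simp_all add: vir_phi_def vir_tau_def)

lemma vir_tau_endomorphism:
  assumes "a \<noteq> 0"
  shows "vir.lie_endomorphism (vir_tau a)"
proof (rule vir_endomorphismI[OF vir_tau_def])
  fix m n
  show "vir_tau a (vir_bracket (vir_L m) (vir_L n)) =
        vir_bracket (vir_tau a (vir_L m)) (vir_tau a (vir_L n))"
  proof -
    have lin: "vir_tau a (x + y) = vir_tau a x + vir_tau a y"
      "vir_tau a (vir_scale c x) = vir_scale c (vir_tau a x)" "vir_tau a 0 = 0" for x y c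
      by (simp_all add: vir_tau_def vir_extend_add vir_extend_scale) (simp add: vir_extend_def)
    show ?thesis
      using assms
      by (auto simp: vir_bracket_L_L lin vir_tau_L vir_tau_C vir_bracket_bilinear
          power_int_add vir_vs.scale_right_distrib power_int_minus mult_ac)
  qed
qed (simp add: vir_tau_C vir_bracket_C_left)

lemma vir_phi_endomorphism:
  assumes "n \<noteq> 0"
  shows "vir.lie_endomorphism (vir_phi n)"
proof (rule vir_endomorphismI[OF vir_phi_def])
  fix i j
  have lin: "vir_phi n (x + y) = vir_phi n x + vir_phi n y"
    "vir_phi n (vir_scale c x) = vir_scale c (vir_phi n x)" "vir_phi n 0 = 0" for x y c
    by (simp_all add: vir_phi_def vir_extend_add vir_extend_scale) (simp add: vir_extend_def)
  have diff: "vir_phi n (x - y) = vir_phi n x - vir_phi n y" for x y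
    using lin(1)[of "x - y" y] by simp
  have br: "vir_bracket (vir_phi n (vir_L i)) (vir_phi n (vir_L j)) =
        vir_scale (1 / of_int n ^ 2) (vir_bracket (vir_L (n * i)) (vir_L (n * j)))"
    by (simp add: vir_phi_L vir_bracket_bilinear vir_bracket_C_left vir_bracket_C_right
        power2_eq_square)
  show "vir_phi n (vir_bracket (vir_L i) (vir_L j)) =
        vir_bracket (vir_phi n (vir_L i)) (vir_phi n (vir_L j))"
  proof (cases "j = - i")
    case True
    show ?thesis
      unfolding br unfolding True using assms
      by (intro poly_mapping_eqI)
        (auto simp: vir_bracket_L_L lin diff vir_phi_L vir_phi_C lookup_add lookup_minus lookup_vir_L lookup_vir_C field_simps power2_eq_square power3_eq_cube)
  next
    case False
    then have "j + i \<noteq> 0" "n * j \<noteq> - (n * i)"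
      using assms by (auto simp: add_eq_0_iff2 simp flip: mult_minus_right)
    then show ?thesis
      unfolding br using assms False
      by (intro poly_mapping_eqI)
        (auto simp: vir_bracket_L_L lin diff vir_phi_L vir_phi_C lookup_add lookup_minus lookup_vir_L lookup_vir_C field_simps power2_eq_square)
  qed
qed (simp add: vir_phi_C vir_bracket_bilinear vir_bracket_C_left)

end

theory Submission
  imports Defs
begin

text \<open>
  If \<open>d\<close> is a differential operator of weight \<open>\<lambda> \<noteq> 0\<close>, then \<open>f = id + \<lambda> d\<close> preserves the
  bracket, because \<open>\<lambda>\<close> times the defining identity of \<open>d\<close> supplies exactly the cross terms of
  \<open>[f x, f y]\<close>. So everything comes down to the endomorphisms \<open>f\<close> of the Virasoro algebra: they are
  \<open>0\<close> and the maps \<open>\<phi>\<^sub>k \<circ> \<tau>\<^sub>a\<close> (lemma \<open>vir_endomorphism_cases\<close>).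

  Let \<open>f \<noteq> 0\<close>. No \<open>f L\<^sub>n\<close> is central, since a central one would kill \<open>f L\<^sub>1\<close>, then \<open>f L\<^sub>0\<close>, and
  then everything (\<open>central_image_trivial\<close>); so each \<open>f L\<^sub>n\<close> has a highest and a lowest degree in the
  grading by \<open>L\<^sub>m \<mapsto> m\<close>. Since \<open>[f L\<^sub>0, f L\<^sub>n] = n f L\<^sub>n\<close>, comparing extreme terms shows
  (\<open>extreme_degree_eigenvector\<close>): if \<open>f L\<^sub>0\<close> has the extreme degree \<open>N \<noteq> 0\<close>, then every \<open>f L\<^sub>n\<close>
  with \<open>n \<noteq> 0\<close> has the same extreme degree \<open>N\<close>; if \<open>N = 0\<close>, the extreme degree of \<open>f L\<^sub>n\<close> is
  proportional to \<open>n\<close>. A nonzero \<open>N\<close> is impossible: when the opposite end \<open>M\<close> of \<open>f L\<^sub>0\<close> is also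
  nonzero, all \<open>f L\<^sub>n\<close> lie in one finite-dimensional space although they are eigenvectors for
  infinitely many eigenvalues; when \<open>M = 0\<close>, one end of \<open>f L\<^sub>n\<close> is fixed at \<open>N\<close> while the other moves
  linearly with \<open>n\<close> and eventually passes it (\<open>L0_extreme_degree_zero\<close>).

  Hence \<open>f L\<^sub>0\<close> has degree \<open>0\<close> and \<open>f L\<^sub>n\<close> is concentrated in degree \<open>n k\<close> for one integer
  \<open>k \<noteq> 0\<close>, modulo the centre. The brackets of the \<open>f L\<^sub>n\<close> make the coefficients, scaled by \<open>k\<close>,
  multiplicative, so they are \<open>a\<^sup>n\<close> (\<open>image_L\<close>), and the brackets
  \<open>[L\<^sub>1, L\<^sub>-\<^sub>1]\<close> and \<open>[L\<^sub>2, L\<^sub>-\<^sub>2]\<close> determine the central part of \<open>f L\<^sub>0\<close> and the value \<open>f C\<close>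
  (\<open>eq_phi_tau\<close>).
\<close>

section \<open>Extreme degrees in the grading\<close>

abbreviation L_coeff :: "vir \<Rightarrow> int \<Rightarrow> complex" where
  "L_coeff x n \<equiv> Poly_Mapping.lookup x (Lix n)"

lemma L_coeff_bracket_L: "L_coeff (vir_bracket (vir_L m) y) k = of_int (k - 2 * m) * L_coeff y (k - m)"
proof (induction y rule: vir_induct)
  case (4 n)
  show ?case
    by (auto simp: vir_bracket_L_L lookup_add lookup_vir_L lookup_vir_C)
qed (simp_all add: vir_bracket_bilinear vir_bracket_C_right lookup_add lookup_vir_C distrib_left
    mult.left_commute)

lemma L_coeff_bracket:
  assumes "finite A" "\<And>m. L_coeff x m \<noteq> 0 \<Longrightarrow> m \<in> A"
  shows "L_coeff (vir_bracket x y) k =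
    (\<Sum>m\<in>A. L_coeff x m * (of_int (k - 2 * m) * L_coeff y (k - m)))"
proof -
  have "Poly_Mapping.keys x \<subseteq> insert Cix (Lix ` A)"
  proof
    fix i assume "i \<in> Poly_Mapping.keys x"
    then show "i \<in> insert Cix (Lix ` A)"
      using assms(2) by (cases i) (auto simp: in_keys_iff)
  qed
  moreover have "finite (insert Cix (Lix ` A))" using assms(1) by simp
  ultimately have "vir_bracket x y =
    (\<Sum>i\<in>insert Cix (Lix ` A). vir_scale (Poly_Mapping.lookup x i) (vir_extend (vir_basis_bracket i) y))"
    unfolding vir_bracket_def by (intro vir_extend_superset)
  also have "\<dots> = vir_scale (Poly_Mapping.lookup x Cix) (vir_bracket vir_C y) +
      (\<Sum>m\<in>A. vir_scale (L_coeff x m) (vir_bracket (vir_L m) y))"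
    using assms(1) by (subst sum.insert) (auto simp: sum.reindex inj_on_def vir_bracket_def)
  finally show ?thesis
    by (simp add: vir_bracket_C_left lookup_add lookup_sum L_coeff_bracket_L)
qed

lemma finite_L_support: "finite {m. L_coeff x m \<noteq> 0}"
  by (rule finite_imageD[where f = Lix], rule finite_subset[of _ "Poly_Mapping.keys x"])
    (auto simp: in_keys_iff inj_on_def)

text \<open>The sign \<open>s\<close> selects the direction: \<open>s = 1\<close> gives the highest degree and \<open>s = -1\<close> the lowest one,
  so that both ends are handled by the same lemmas. Only the part of \<open>x\<close> outside the centre counts.\<close>

definition extreme_degree :: "int \<Rightarrow> vir \<Rightarrow> int \<Rightarrow> bool" where
  "extreme_degree s x N \<longleftrightarrow> L_coeff x N \<noteq> 0 \<and> (\<forall>i. L_coeff x i \<noteq> 0 \<longrightarrow> s * i \<le> s * N)"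

lemma extreme_degree_exists:
  assumes "L_coeff x m \<noteq> 0"
  obtains N where "extreme_degree s x N"
proof -
  let ?S = "{m. L_coeff x m \<noteq> 0}"
  let ?M = "Max ((*) s ` ?S)"
  have fin: "finite ((*) s ` ?S)" using finite_L_support by blast
  moreover have "(*) s ` ?S \<noteq> {}" using assms by auto
  ultimately have "?M \<in> (*) s ` ?S" by (rule Max_in)
  then obtain N where N: "L_coeff x N \<noteq> 0" "?M = s * N" by auto
  then show ?thesis
    using that[of N] Max_ge[OF fin] by (auto simp: extreme_degree_def)
qed

lemma extreme_degree_bracket_le:
  assumes x: "extreme_degree s x N" and y: "extreme_degree s y K"
    and "L_coeff (vir_bracket x y) k \<noteq> 0"
  shows "s * k \<le> s * (N + K)"
proof -
  have "(\<Sum>m\<in>{m. L_coeff x m \<noteq> 0}. L_coeff x m * (of_int (k - 2 * m) * L_coeff y (k - m))) \<noteq> 0"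
    using assms(3) by (subst (asm) L_coeff_bracket[OF finite_L_support[of x]]) auto
  then obtain m where "L_coeff x m \<noteq> 0" "L_coeff y (k - m) \<noteq> 0"
    by (rule sum.not_neutral_contains_not_neutral) auto
  then have "s * m \<le> s * N" "s * (k - m) \<le> s * K"
    using x y by (auto simp: extreme_degree_def)
  then show ?thesis by (simp add: algebra_simps)
qed

text \<open>Only the product of the two extreme terms reaches degree \<open>N + K\<close>. Its structure constant \<open>K - N\<close>
  vanishes exactly when the two degrees agree, which is what makes the dichotomy below possible.\<close>

lemma extreme_coeff_bracket:
  assumes s: "s \<noteq> 0" and x: "extreme_degree s x N" and y: "extreme_degree s y K"
  shows "L_coeff (vir_bracket x y) (N + K) = of_int (K - N) * L_coeff x N * L_coeff y K"
proof -
  let ?S = "{m. L_coeff x m \<noteq> 0}"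
  let ?t = "\<lambda>m. L_coeff x m * (of_int (N + K - 2 * m) * L_coeff y (N + K - m))"
  have "L_coeff (vir_bracket x y) (N + K) = sum ?t ?S"
    by (rule L_coeff_bracket[OF finite_L_support]) auto
  also have "\<dots> = sum ?t {N}"
  proof (rule sum.mono_neutral_right[OF finite_L_support])
    show "{N} \<subseteq> ?S" using x by (simp add: extreme_degree_def)
    show "\<forall>m\<in>?S - {N}. ?t m = 0"
    proof
      fix m assume m: "m \<in> ?S - {N}"
      have "L_coeff y (N + K - m) = 0"
      proof (rule ccontr)
        assume "L_coeff y (N + K - m) \<noteq> 0"
        then have "s * (N + K - m) \<le> s * K" using y by (simp add: extreme_degree_def)
        moreover have "s * m \<le> s * N" using m x by (simp add: extreme_degree_def)
        ultimately have "s * m = s * N" by (simp add: algebra_simps)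
        then show False using s m by simp
      qed
      then show "?t m = 0" by simp
    qed
  qed
  finally show ?thesis by (simp add: algebra_simps)
qed

text \<open>If \<open>K \<noteq> N\<close>, the extreme term of \<open>[v, e]\<close> survives in degree \<open>N + K\<close>, but \<open>c e\<close> has extreme
  degree \<open>K\<close>; this forces \<open>N = 0\<close>, and the extreme coefficients then give the eigenvalue.
  If \<open>K = N\<close>, the case \<open>N = 0\<close> is excluded because the term of degree \<open>0\<close> would cancel.\<close>

lemma extreme_degree_eigenvector:
  assumes s: "s \<noteq> 0" and v: "extreme_degree s v N" and e: "extreme_degree s e K"
    and eig: "vir_bracket v e = vir_scale c e" and c: "c \<noteq> 0"
  shows "if N = 0 then of_int K * L_coeff v 0 = c else K = N"
proof -
  have coeff: "of_int (K - N) * L_coeff v N * L_coeff e K = c * L_coeff e (N + K)"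
    using extreme_coeff_bracket[OF s v e] by (simp add: eig)
  have nz: "L_coeff v N \<noteq> 0" "L_coeff e K \<noteq> 0"
    using v e by (auto simp: extreme_degree_def)
  have "s * K \<le> s * (N + K)"
    by (rule extreme_degree_bracket_le[OF v e]) (use nz c in \<open>simp add: eig\<close>)
  then have ge: "0 \<le> s * N" by (simp add: algebra_simps)
  show ?thesis
  proof (cases "K = N")
    case True
    then show ?thesis using coeff nz c by auto
  next
    case False
    then have "L_coeff e (N + K) \<noteq> 0" using coeff nz by auto
    then have "s * (N + K) \<le> s * K" using e by (simp add: extreme_degree_def)
    then have "s * N = 0" using ge by (simp add: algebra_simps)
    then have "N = 0" using s by simp
    then show ?thesis using coeff nz by simp
  qed
qed

section \<open>Independence of eigenvectors\<close>

text \<open>Applying \<open>T - \<mu> j\<close> to a vanishing combination removes the term of index \<open>j\<close> and multiplies the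
  other coefficients by the nonzero numbers \<open>\<mu> i - \<mu> j\<close>.\<close>

lemma (in vector_space) eigenvectors_sum_zero:
  assumes "Vector_Spaces.linear scale scale T"
    and "finite A" "inj_on \<mu> A"
    and "\<And>i. i \<in> A \<Longrightarrow> T (v i) = scale (\<mu> i) (v i)" "\<And>i. i \<in> A \<Longrightarrow> v i \<noteq> 0"
    and "(\<Sum>i\<in>A. scale (c i) (v i)) = 0"
  shows "\<forall>i\<in>A. c i = 0"
  using assms(2-)
proof (induction A arbitrary: c rule: finite_induct)
  case (insert j A)
  interpret T: Vector_Spaces.linear scale scale T by fact
  have sum: "scale (c j) (v j) + (\<Sum>i\<in>A. scale (c i) (v i)) = 0"
    using insert by simp
  have T_eq: "T (scale (c j) (v j) + (\<Sum>i\<in>A. scale (c i) (v i))) =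
      scale (\<mu> j) (scale (c j) (v j)) + (\<Sum>i\<in>A. scale (\<mu> i) (scale (c i) (v i)))"
    using insert.prems(2) by (simp add: T.add T.sum T.scale mult.commute)
  have T_sum: "scale (\<mu> j) (scale (c j) (v j)) + (\<Sum>i\<in>A. scale (\<mu> i) (scale (c i) (v i))) = 0"
    using T_eq[symmetric] unfolding sum T.zero .
  have "(\<Sum>i\<in>A. scale ((\<mu> i - \<mu> j) * c i) (v i)) =
      (scale (\<mu> j) (scale (c j) (v j)) + (\<Sum>i\<in>A. scale (\<mu> i) (scale (c i) (v i)))) -
      scale (\<mu> j) (scale (c j) (v j) + (\<Sum>i\<in>A. scale (c i) (v i)))"
    by (simp add: scale_right_distrib scale_sum_right left_diff_distrib scale_left_diff_distrib
        sum_subtractf)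
  also have "\<dots> = 0" unfolding sum T_sum by simp
  finally have "\<forall>i\<in>A. (\<mu> i - \<mu> j) * c i = 0"
    using insert by (intro insert.IH) auto
  moreover have "\<mu> i \<noteq> \<mu> j" if "i \<in> A" for i
    using that insert by (auto simp: inj_on_def)
  ultimately have A: "\<forall>i\<in>A. c i = 0" by auto
  then have "scale (c j) (v j) = 0" using sum by simp
  then show ?case using A insert.prems(3) by simp
qed simp

lemma (in vector_space) eigenvectors_card_le:
  assumes T: "Vector_Spaces.linear scale scale T"
    and A: "finite A" "inj_on \<mu> A"
    and v: "\<And>i. i \<in> A \<Longrightarrow> T (v i) = scale (\<mu> i) (v i)" "\<And>i. i \<in> A \<Longrightarrow> v i \<noteq> 0"
    and B: "finite B" "v ` A \<subseteq> span B"
  shows "card A \<le> card B"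
proof -
  have inj: "inj_on v A"
  proof (rule inj_onI)
    fix i j assume ij: "i \<in> A" "j \<in> A" "v i = v j"
    then have "scale (\<mu> i) (v i) = scale (\<mu> j) (v i)" by (metis v(1))
    then have "\<mu> i = \<mu> j" using v(2)[OF ij(1)] scale_right_imp_eq by blast
    then show "i = j" using A(2) ij by (simp add: inj_on_def)
  qed
  have "independent (v ` A)"
  proof (rule independent_if_scalars_zero)
    fix g x assume "(\<Sum>x\<in>v ` A. scale (g x) x) = 0" "x \<in> v ` A"
    then show "g x = 0"
      using eigenvectors_sum_zero[OF T A v, of "g \<circ> v"] inj by (auto simp: sum.reindex)
  qed (use A in simp)
  then have "card (v ` A) \<le> card B"
    using independent_span_bound[OF B(1) _ B(2)] by simp
  then show ?thesis using inj by (simp add: card_image)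
qed

text \<open>Elements of the Virasoro algebra whose degrees all lie in a finite set \<open>D\<close> span a space of
  dimension at most \<open>card D + 1\<close>, the extra dimension being the centre.\<close>

lemma infinite_eigenvectors_not_span:
  assumes T: "Vector_Spaces.linear vir_scale vir_scale T"
    and I: "infinite I" "inj_on \<mu> I"
    and v: "\<And>i. i \<in> I \<Longrightarrow> T (v i) = vir_scale (\<mu> i) (v i)" "\<And>i. i \<in> I \<Longrightarrow> v i \<noteq> 0"
    and D: "finite D" "\<And>i m. i \<in> I \<Longrightarrow> L_coeff (v i) m \<noteq> 0 \<Longrightarrow> m \<in> D"
  shows False
proof -
  define B where "B = insert vir_C (vir_L ` D)"
  have fin: "finite B" using D by (simp add: B_def)
  obtain A where A: "A \<subseteq> I" "finite A" "card A = Suc (card B)"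
    using infinite_arbitrarily_large[OF I(1)] by metis
  have "v i \<in> vir_vs.span B" if "i \<in> A" for i
  proof -
    have *: "Poly_Mapping.single k 1 \<in> B" if "k \<in> Poly_Mapping.keys (v i)" for k
      using that D(2)[of i] \<open>i \<in> A\<close> A(1)
      by (cases k) (auto simp: B_def vir_C_def vir_L_def in_keys_iff)
    have "vir_extend (\<lambda>i. Poly_Mapping.single i 1) (v i) \<in> vir_vs.span B"
      unfolding vir_extend_def
      by (intro vir_vs.span_sum vir_vs.span_scale vir_vs.span_base *)
    then show ?thesis using vir_expand[of "v i"] by simp
  qed
  then have "card A \<le> card B"
    using A I v
    by (intro vir_vs.eigenvectors_card_le[OF T, of A \<mu> v B] fin) (auto intro: inj_on_subset)
  then show False using A by simp
qed

section \<open>Endomorphisms of the Virasoro algebra\<close>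

lemma vir_eqI:
  assumes "\<And>n. L_coeff x n = L_coeff y n" "Poly_Mapping.lookup x Cix = Poly_Mapping.lookup y Cix"
  shows "x = y"
proof (rule poly_mapping_eqI)
  fix i show "Poly_Mapping.lookup x i = Poly_Mapping.lookup y i"
    using assms by (cases i) auto
qed

lemma bracket_central:
  assumes "\<And>n. L_coeff x n = 0"
  shows "vir_bracket x y = 0"
proof -
  have "x = vir_scale (Poly_Mapping.lookup x Cix) vir_C"
    by (rule vir_eqI) (simp_all add: assms lookup_vir_C)
  then show ?thesis
    by (metis vir_bracket_scale_left vir_bracket_C_left vir_vs.scale_zero_right)
qed

locale vir_endomorphism =
  fixes f :: "vir \<Rightarrow> vir"
  assumes endo: "vir.lie_endomorphism f"
begin

sublocale f: Vector_Spaces.linear vir_scale vir_scale f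
  using endo by (simp add: vir.lie_endomorphism_def)

lemma f_bracket: "f (vir_bracket x y) = vir_bracket (f x) (f y)"
  using endo by (simp add: vir.lie_endomorphism_def)

lemma bracket_f_L:
  "vir_bracket (f (vir_L m)) (f (vir_L n)) =
     vir_scale (of_int (n - m)) (f (vir_L (n + m))) +
     (if n = - m then vir_scale ((of_int m ^ 3 - of_int m) / 12) (f vir_C) else 0)"
  by (simp add: vir_bracket_L_L f.add f.scale f.zero flip: f_bracket)

lemma bracket_f_L0: "vir_bracket (f (vir_L 0)) (f (vir_L n)) = vir_scale (of_int n) (f (vir_L n))"
  by (simp add: bracket_f_L)

text \<open>The index \<open>1 - n\<close> is chosen so that the bracket of \<open>L\<^sub>n\<close> with it is \<open>(1 - 2 n) L\<^sub>1\<close>, a nonzero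
  multiple for every integer \<open>n\<close>, without a central term. The elements \<open>L\<^sub>1\<close> and \<open>L\<^sub>-\<^sub>1\<close> then yield \<open>L\<^sub>0\<close>,
  which acts on \<open>L\<^sub>m\<close> by \<open>m\<close>, and the pair \<open>L\<^sub>2\<close>, \<open>L\<^sub>-\<^sub>2\<close> reaches \<open>C\<close>.\<close>

lemma central_image_trivial:
  assumes "\<And>m. L_coeff (f (vir_L n)) m = 0"
  shows "f x = 0"
proof -
  have central: "vir_bracket (f (vir_L n)) y = 0" for y
    using assms by (rule bracket_central)
  have "vir_scale (of_int (1 - 2 * n)) (f (vir_L 1)) = 0"
    using bracket_f_L[of n "1 - n"] by (simp add: central)
  moreover have "1 - 2 * n \<noteq> 0" by presburger
  ultimately have L1: "f (vir_L 1) = 0" by (metis vir_vs.scale_eq_0_iff of_int_eq_0_iff)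
  have L0: "f (vir_L 0) = 0"
    using bracket_f_L[of 1 "-1"] by (simp add: L1 vir_bracket_zero_left)
  have L: "f (vir_L m) = 0" for m
    using bracket_f_L0[of m] by (cases "m = 0") (auto simp: L0 vir_bracket_zero_left)
  have "vir_scale (1 / 2) (f vir_C) = 0"
    using bracket_f_L[of 2 "-2"] by (simp add: L vir_bracket_zero_left)
  then have C: "f vir_C = 0" by simp
  show ?thesis
    by (induction x rule: vir_induct) (simp_all add: f.add f.scale f.zero L C)
qed

end

locale nonzero_vir_endomorphism = vir_endomorphism +
  assumes nonzero: "\<exists>x. f x \<noteq> 0"
begin

lemma image_extreme_degree:
  obtains K where "extreme_degree s (f (vir_L n)) K"
  using central_image_trivial[of n] nonzero extreme_degree_exists by metis

text \<open>Let \<open>N \<noteq> 0\<close> and let \<open>M\<close> be the opposite end of \<open>f L\<^sub>0\<close>. One end of every \<open>f L\<^sub>n\<close> is then \<open>N\<close>.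
  If \<open>M = 0\<close>, the other end is \<open>n\<close> times that of \<open>f L\<^sub>1\<close> and passes \<open>N\<close> for a suitable \<open>n\<close>.
  If \<open>M \<noteq> 0\<close>, all \<open>f L\<^sub>n\<close> with \<open>n \<noteq> 0\<close> have their degrees between \<open>M\<close> and \<open>N\<close>, too few for
  infinitely many eigenvalues.\<close>

lemma L0_extreme_degree_zero:
  assumes s: "s = 1 \<or> s = -1" and N: "extreme_degree s (f (vir_L 0)) N"
  shows "N = 0"
proof (rule ccontr)
  assume "N \<noteq> 0"
  have eig: "if N = 0 then of_int K * L_coeff (f (vir_L 0)) 0 = of_int n else K = N"
    if "n \<noteq> 0" "extreme_degree t (f (vir_L 0)) N" "extreme_degree t (f (vir_L n)) K" "t \<noteq> 0"
    for t n N K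
    by (rule extreme_degree_eigenvector[OF that(4,2,3) bracket_f_L0]) (use that in simp)
  have top: "s * i \<le> s * N" if "n \<noteq> 0" "L_coeff (f (vir_L n)) i \<noteq> 0" for n i
  proof -
    obtain K where K: "extreme_degree s (f (vir_L n)) K" by (rule image_extreme_degree)
    then have "K = N" using eig[OF that(1) N K] s \<open>N \<noteq> 0\<close> by auto
    then show ?thesis using K that by (simp add: extreme_degree_def)
  qed
  obtain M where M: "extreme_degree (- s) (f (vir_L 0)) M" by (rule image_extreme_degree)
  show False
  proof (cases "M = 0")
    case True
    have "\<exists>K. extreme_degree (- s) (f (vir_L n)) K" for n by (meson image_extreme_degree)
    then obtain K where K: "\<And>n. extreme_degree (- s) (f (vir_L n)) (K n)" by metis
    have deg: "of_int (K n) * L_coeff (f (vir_L 0)) 0 = of_int n" if "n \<noteq> 0" for n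
      using eig[OF that M K] s True by auto
    have K_mult: "K n = n * K 1" if "n \<noteq> 0" for n
    proof -
      have "of_int (K n) * L_coeff (f (vir_L 0)) 0 = of_int (n * K 1) * L_coeff (f (vir_L 0)) 0"
        using deg[OF that] deg[of 1] by simp
      moreover have "L_coeff (f (vir_L 0)) 0 \<noteq> 0" using deg[of 1] by auto
      ultimately show ?thesis by (metis mult_right_cancel of_int_eq_iff)
    qed
    have K1: "K 1 \<noteq> 0" using deg[of 1] by auto
    \<comment> \<open>The sign of \<open>n\<close> moves the far end towards \<open>N\<close>, and its size carries it past \<open>N\<close>.\<close>
    let ?n = "s * K 1 * (\<bar>N\<bar> + 1)"
    have n: "?n \<noteq> 0" using K1 s by auto
    have "1 * (\<bar>N\<bar> + 1) \<le> (K 1)\<^sup>2 * (\<bar>N\<bar> + 1)"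
      by (rule mult_right_mono) (use K1 in \<open>auto simp: int_one_le_iff_zero_less\<close>)
    also have "\<dots> = s * K ?n"
      using s K_mult[OF n] by (auto simp: power2_eq_square)
    also have "\<dots> \<le> s * N" by (rule top[OF n]) (use K in \<open>simp add: extreme_degree_def\<close>)
    also have "\<dots> \<le> \<bar>N\<bar>" using s by auto
    finally show False by simp
  next
    case False
    have bottom: "- s * i \<le> - s * M" if "n \<noteq> 0" "L_coeff (f (vir_L n)) i \<noteq> 0" for n i
    proof -
      obtain K where K: "extreme_degree (- s) (f (vir_L n)) K" by (rule image_extreme_degree)
      then have "K = M" using eig[OF that(1) M K] s False by auto
      then show ?thesis using K that by (simp add: extreme_degree_def)
    qed
    show False
    proof (rule infinite_eigenvectors_not_span)
      show "Vector_Spaces.linear vir_scale vir_scale (vir_bracket (f (vir_L 0)))"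
        by (rule vir.bracket_linear_right)
      show "infinite (- {0 :: int})" by (simp add: finite_compl infinite_UNIV_char_0)
      show "inj_on (of_int :: int \<Rightarrow> complex) (- {0})" by (simp add: inj_on_def)
      show "vir_bracket (f (vir_L 0)) (f (vir_L n)) = vir_scale (of_int n) (f (vir_L n))" for n
        by (rule bracket_f_L0)
      show "f (vir_L n) \<noteq> 0" for n
      proof -
        obtain K where "extreme_degree 1 (f (vir_L n)) K" by (rule image_extreme_degree)
        then show ?thesis by (auto simp: extreme_degree_def)
      qed
      \<comment> \<open>This interval around \<open>0\<close> contains the degrees between \<open>M\<close> and \<open>N\<close> for either sign \<open>s\<close>.\<close>
      show "finite {- (\<bar>M\<bar> + \<bar>N\<bar>)..\<bar>M\<bar> + \<bar>N\<bar>}" by simp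
      show "i \<in> {- (\<bar>M\<bar> + \<bar>N\<bar>)..\<bar>M\<bar> + \<bar>N\<bar>}" if "n \<in> - {0}" "L_coeff (f (vir_L n)) i \<noteq> 0" for n i
        using top[of n i] bottom[of n i] that s by auto
    qed
  qed
qed

text \<open>Both ends of \<open>f L\<^sub>0\<close> are \<open>0\<close>, so both ends of \<open>f L\<^sub>n\<close> solve the same equation, \<open>K\<close> times the
  coefficient of \<open>f L\<^sub>0\<close> equals \<open>n\<close>, and therefore coincide.\<close>

lemma image_homogeneous:
  obtains k where "k \<noteq> 0" "of_int k * L_coeff (f (vir_L 0)) 0 = 1"
    and "\<And>n i. L_coeff (f (vir_L n)) i \<noteq> 0 \<Longrightarrow> i = n * k"
proof -
  let ?\<alpha> = "L_coeff (f (vir_L 0)) 0"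
  have zero: "extreme_degree s (f (vir_L 0)) 0" if "s = 1 \<or> s = -1" for s
    using image_extreme_degree[of s 0] L0_extreme_degree_zero[OF that] by metis
  have deg: "of_int K * ?\<alpha> = of_int n"
    if "s = 1 \<or> s = -1" "n \<noteq> 0" "extreme_degree s (f (vir_L n)) K" for s n K
    using extreme_degree_eigenvector[OF _ zero[OF that(1)] that(3) bracket_f_L0] that by auto
  obtain k where "extreme_degree 1 (f (vir_L 1)) k" by (rule image_extreme_degree)
  then have k: "of_int k * ?\<alpha> = 1" using deg[of 1 1 k] by simp
  have k0: "k \<noteq> 0" and \<alpha>: "?\<alpha> \<noteq> 0" using k by auto
  have extreme: "extreme_degree s (f (vir_L n)) (n * k)" if s: "s = 1 \<or> s = -1" for s n
  proof (cases "n = 0")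
    case True
    then show ?thesis using zero[OF s] by simp
  next
    case False
    obtain K where K: "extreme_degree s (f (vir_L n)) K" by (rule image_extreme_degree)
    have "of_int K * ?\<alpha> = of_int (n * k) * ?\<alpha>" using deg[OF s False K] k by simp
    then have "K = n * k" using \<alpha> by (metis mult_right_cancel of_int_eq_iff)
    then show ?thesis using K by simp
  qed
  show ?thesis
  proof (rule that[OF k0 k])
    fix n i assume "L_coeff (f (vir_L n)) i \<noteq> 0"
    then have "1 * i \<le> 1 * (n * k)" "-1 * i \<le> -1 * (n * k)"
      using extreme[of 1 n] extreme[of "-1" n] unfolding extreme_degree_def by blast+
    then show "i = n * k" by simp
  qed
qed

text \<open>The eigenvalue equation for \<open>f L\<^sub>0\<close> leaves no central part in \<open>f L\<^sub>n\<close> for \<open>n \<noteq> 0\<close>. For \<open>n = 0\<close>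
  it carries no information, and the central part \<open>\<gamma>\<close> remains to be determined.\<close>

lemma image_L:
  obtains k a where "k \<noteq> 0" "a \<noteq> 0"
    and "\<And>n. n \<noteq> 0 \<Longrightarrow> f (vir_L n) = vir_scale (a powi n / of_int k) (vir_L (k * n))"
    and "\<exists>\<gamma>. f (vir_L 0) = vir_scale (1 / of_int k) (vir_L 0) + vir_scale \<gamma> vir_C"
proof -
  obtain k where k: "k \<noteq> 0" "of_int k * L_coeff (f (vir_L 0)) 0 = 1"
    and hom: "\<And>n i. L_coeff (f (vir_L n)) i \<noteq> 0 \<Longrightarrow> i = n * k"
    using image_homogeneous by blast
  define b where "b n = of_int k * L_coeff (f (vir_L n)) (n * k)" for n
  define c where "c n = Poly_Mapping.lookup (f (vir_L n)) Cix" for n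
  have b0: "b 0 = 1" using k by (simp add: b_def)
  have image: "f (vir_L n) = vir_scale (b n / of_int k) (vir_L (k * n)) + vir_scale (c n) vir_C" for n
    using k(1) hom[of n]
    by (intro vir_eqI) (auto simp: lookup_add lookup_vir_L lookup_vir_C b_def c_def mult.commute)
  have c: "c n = 0" if "n \<noteq> 0" for n
  proof -
    have "Poly_Mapping.lookup (vir_bracket (f (vir_L 0)) (f (vir_L n))) Cix = 0"
      by (subst (1 2) image)
        (use k that in \<open>simp add: vir_bracket_bilinear vir_bracket_C_left vir_bracket_C_right
          vir_bracket_L_L lookup_vir_L\<close>)
    then show ?thesis using that by (simp add: bracket_f_L0 c_def)
  qed
  \<comment> \<open>The image of \<open>[L\<^sub>m, L\<^sub>-\<^sub>m]\<close> involves \<open>f C\<close>, of which nothing is known yet, except for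
    \<open>m = 1\<close>, where \<open>m^3 - m\<close> vanishes.\<close>
  have mult: "b m * b n = b (n + m)" if "m \<noteq> 0" "n \<noteq> 0" "n \<noteq> m" "n = - m \<Longrightarrow> m = 1" for m n
  proof -
    have *: "vir_bracket (f (vir_L m)) (f (vir_L n)) = vir_scale (of_int (n - m)) (f (vir_L (n + m)))"
      using that by (auto simp: bracket_f_L)
    have "of_int (n - m) * b m * b n / of_int k =
        L_coeff (vir_bracket (f (vir_L m)) (f (vir_L n))) (k * (n + m))"
      using that(1,2) k(1)
      by (subst (1 2) image) (simp add: c vir_bracket_bilinear vir_bracket_L_L lookup_add
          lookup_minus lookup_vir_L lookup_vir_C field_simps)
    also have "\<dots> = of_int (n - m) * b (n + m) / of_int k"
      unfolding * using k(1) by (simp add: b_def mult.commute)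
    finally have "of_int (n - m) * (b m * b n) = of_int (n - m) * b (n + m)"
      using k(1) by (simp add: divide_cancel_right mult.assoc del: of_int_diff)
    moreover have "of_int (n - m) \<noteq> (0 :: complex)" using that(3) by simp
    ultimately show ?thesis by (metis mult_left_cancel)
  qed
  have inv: "b 1 * b (-1) = 1" using mult[of 1 "-1"] b0 by simp
  then have a0: "b 1 \<noteq> 0" by auto
  \<comment> \<open>The bracket of \<open>L\<^sub>1\<close> with itself is zero and says nothing about \<open>b 2\<close>; \<open>[L\<^sub>2, L\<^sub>-\<^sub>1]\<close> does.\<close>
  have "b 2 * b (-1) = b 1" using mult[of 2 "-1"] by simp
  then have b2: "b 2 = b 1 * b 1" using inv a0 by (metis mult.assoc mult.commute mult.right_neutral)
  have step: "b (n + 1) = b n * b 1" for n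
  proof -
    consider "n = 0" | "n = 1" | "n = -1" | "n \<noteq> 0" "n \<noteq> 1" "n \<noteq> -1" by blast
    then show ?thesis
      using mult[of 1 n] by cases (simp_all add: b0 b2 inv mult.commute)
  qed
  have power: "b n = b 1 powi n" for n
  proof (induction n rule: int_induct[where k = 0])
    case (step1 i)
    then show ?case using step[of i] a0 by (simp add: power_int_add)
  next
    case (step2 i)
    then show ?case using step[of "i - 1"] a0 by (simp add: power_int_diff field_simps)
  qed (simp add: b0)
  show ?thesis
  proof (rule that[OF k(1) a0])
    show "f (vir_L n) = vir_scale (b 1 powi n / of_int k) (vir_L (k * n))" if "n \<noteq> 0" for n
      using image[of n] c[OF that] by (simp flip: power)
    show "\<exists>\<gamma>. f (vir_L 0) = vir_scale (1 / of_int k) (vir_L 0) + vir_scale \<gamma> vir_C"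
      using image[of 0] b0 by auto
  qed
qed

text \<open>The remaining unknowns \<open>\<gamma>\<close> and \<open>f C\<close> are found by applying \<open>f\<close> to \<open>[L\<^sub>m, L\<^sub>-\<^sub>m]\<close> and comparing
  with \<open>[L\<^sub>k\<^sub>m, L\<^sub>-\<^sub>k\<^sub>m] / k^2\<close>.\<close>

lemma eq_phi_tau:
  obtains k a where "k \<noteq> 0" "a \<noteq> 0" "f = vir_phi k \<circ> vir_tau a"
proof -
  obtain k a \<gamma> where k: "k \<noteq> 0" and a: "a \<noteq> 0"
    and L: "\<And>n. n \<noteq> 0 \<Longrightarrow> f (vir_L n) = vir_scale (a powi n / of_int k) (vir_L (k * n))"
    and L0: "f (vir_L 0) = vir_scale (1 / of_int k) (vir_L 0) + vir_scale \<gamma> vir_C"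
    using image_L by metis
  have br: "vir_scale (1 / of_int k ^ 2) (vir_bracket (vir_L (k * m)) (vir_L (- (k * m)))) =
      vir_scale (- 2 * of_int m) (f (vir_L 0)) +
      vir_scale ((of_int m ^ 3 - of_int m) / 12) (f vir_C)"
    if "m \<noteq> 0" for m
    using bracket_f_L[of m "- m"] that a
    by (simp add: L vir_bracket_bilinear power_int_minus power2_eq_square)
  \<comment> \<open>For \<open>m = 1\<close> the term with \<open>f C\<close> drops out, and the central coefficients give \<open>\<gamma>\<close>.\<close>
  have "- (2 * \<gamma>) = (of_int k ^ 3 - of_int k) / (12 * of_int k ^ 2)"
    using arg_cong[OF br[of 1], of "\<lambda>x. Poly_Mapping.lookup x Cix"]
    by (simp add: L0 vir_bracket_L_L lookup_add lookup_minus lookup_vir_L lookup_vir_C mult.commute)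
  then have "of_int k ^ 3 - of_int k = - (2 * \<gamma>) * (12 * of_int k ^ 2)"
    using k by (simp add: eq_divide_eq)
  then have "of_int k * (\<gamma> * (24 * of_int k)) = of_int k * - (of_int k ^ 2 - 1)"
    by algebra
  then have "\<gamma> * (24 * of_int k) = - (of_int k ^ 2 - 1)"
    using k by (metis mult_left_cancel of_int_eq_0_iff)
  then have \<gamma>: "\<gamma> = - (of_int k ^ 2 - 1) / (24 * of_int k)"
    using k by (simp add: nonzero_eq_divide_eq)
  \<comment> \<open>For \<open>m = 2\<close> the coefficient of \<open>f C\<close> is \<open>(8 - 2) / 12 = 1 / 2\<close>.\<close>
  have "f vir_C = vir_scale 2 (vir_scale (1 / of_int k ^ 2)
      (vir_bracket (vir_L (k * 2)) (vir_L (- (k * 2)))) + vir_scale 4 (f (vir_L 0)))"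
    using br[of 2] by (simp add: vir_vs.scale_right_distrib)
  also have "\<dots> = vir_scale (of_int k) vir_C"
    using k by (intro poly_mapping_eqI)
      (auto simp: L0 \<gamma> vir_bracket_L_L lookup_add lookup_vir_L lookup_vir_C field_simps
        power2_eq_square power3_eq_cube)
  finally have C: "f vir_C = vir_scale (of_int k) vir_C" .
  have phi: "vir_phi k (x + y) = vir_phi k x + vir_phi k y"
    "vir_phi k (vir_scale c x) = vir_scale c (vir_phi k x)" "vir_phi k 0 = 0" for x y c
    by (simp_all add: vir_phi_def vir_extend_add vir_extend_scale) (simp add: vir_extend_def)
  have tau: "vir_tau a (x + y) = vir_tau a x + vir_tau a y"
    "vir_tau a (vir_scale c x) = vir_scale c (vir_tau a x)" "vir_tau a 0 = 0" for x y c
    by (simp_all add: vir_tau_def vir_extend_add vir_extend_scale) (simp add: vir_extend_def)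
  have "f x = vir_phi k (vir_tau a x)" for x
  proof (induction x rule: vir_induct)
    case (4 n)
    show ?case
    proof (cases "n = 0")
      case True
      show ?thesis
        by (rule poly_mapping_eqI)
          (use k in \<open>simp add: True L0 \<gamma> vir_tau_L vir_phi_L phi lookup_add lookup_minus
            lookup_vir_L lookup_vir_C field_simps\<close>)
    qed (simp add: L vir_tau_L vir_phi_L phi)
  qed (simp_all add: f.add f.scale f.zero phi tau C vir_tau_C vir_phi_C)
  then show ?thesis by (intro that[OF k a]) (simp add: fun_eq_iff)
qed

end

lemma vir_endomorphism_cases:
  assumes "vir.lie_endomorphism f"
  obtains "f = (\<lambda>x. 0)" | k a where "k \<noteq> 0" "a \<noteq> 0" "f = vir_phi k \<circ> vir_tau a"
proof (cases "\<exists>x. f x \<noteq> 0")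
  case True
  then interpret nonzero_vir_endomorphism f
    using assms by unfold_locales
  show ?thesis using eq_phi_tau that(2) by blast
qed (use that in auto)

section \<open>Differential operators\<close>

lemma (in complex_lie_algebra) differential_operator_imp_endomorphism:
  assumes "differential_operator lam d"
  shows "lie_endomorphism (\<lambda>x. x + scale lam (d x))"
proof -
  interpret d: Vector_Spaces.linear scale scale d
    using assms by (simp add: differential_operator_def)
  interpret left: Vector_Spaces.linear scale scale "\<lambda>x. bracket x y" for y
    by (rule bracket_linear_left)
  interpret right: Vector_Spaces.linear scale scale "bracket x" for x
    by (rule bracket_linear_right)
  have "Vector_Spaces.linear scale scale (\<lambda>x. x + scale lam (d x))"
    by unfold_locales (simp_all add: d.add d.scale scale_right_distrib algebra_simps)
  moreover have "d (bracket x y) =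
      bracket (d x) y + bracket x (d y) + scale lam (bracket (d x) (d y))" for x y
    using assms by (simp add: differential_operator_def)
  ultimately show ?thesis
    by (simp add: lie_endomorphism_def left.add right.add left.scale right.scale
        scale_right_distrib ac_simps)
qed

text \<open>The operator is recovered from the endomorphism \<open>f = id + \<lambda> d\<close> as \<open>d = (f - id) / \<lambda>\<close>; the zero
  endomorphism corresponds to \<open>d\<^sub>0\<^sub>,\<^sub>0\<close> and \<open>\<phi>\<^sub>n \<circ> \<tau>\<^sub>a\<close> to \<open>d\<^sub>n\<^sub>,\<^sub>a\<close>.\<close>

lemma vir_differential_operator_cases:
  assumes lam: "lam \<noteq> 0" and d: "vir.differential_operator lam d"
  shows "d = (\<lambda>x. vir_scale (inverse lam) (vir_d00 x)) \<or>
    (\<exists>n a. n \<noteq> 0 \<and> a \<noteq> 0 \<and> d = (\<lambda>x. vir_scale (inverse lam) (vir_d n a x)))"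
proof -
  define f where "f = (\<lambda>x. x + vir_scale lam (d x))"
  have d_eq: "d = (\<lambda>x. vir_scale (inverse lam) (f x - x))"
    using lam by (auto simp: f_def)
  have "vir.lie_endomorphism f"
    unfolding f_def using d by (rule vir.differential_operator_imp_endomorphism)
  then show ?thesis
  proof (cases rule: vir_endomorphism_cases)
    case 1
    then have "d = (\<lambda>x. vir_scale (inverse lam) (vir_d00 x))"
      by (simp add: d_eq vir_d00_def)
    then show ?thesis ..
  next
    case (2 k a)
    then have "d = (\<lambda>x. vir_scale (inverse lam) (vir_d k a x))"
      by (simp add: d_eq vir_d_def)
    then show ?thesis using 2 by blast
  qed
qed

theorem theorem2p3:
  shows "(\<forall>d. vir.differential_operator 1 d \<longrightarrow>
            d = vir_d00 \<or> (\<exists>n a. n \<noteq> 0 \<and> a \<noteq> 0 \<and> d = vir_d n a)) \<and>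
         (\<forall>(lam::complex) d. lam \<noteq> 0 \<longrightarrow> vir.differential_operator lam d \<longrightarrow>
            d = (\<lambda>x. vir_scale (inverse lam) (vir_d00 x)) \<or>
            (\<exists>n a. n \<noteq> 0 \<and> a \<noteq> 0 \<and> d = (\<lambda>x. vir_scale (inverse lam) (vir_d n a x))))"
  using vir_differential_operator_cases[of 1] vir_differential_operator_cases by simp

end
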